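(* Let $s$ be a positive integer and let $\lambda=(\lambda_1,\lambda_2,\dots,\lambda_{\ell})$ be a strict partition. Then $S(\lambda)$ is an $s$-CSYD if and only if both of the following hold: (a) $\lambda$ is an $\overline{s}$-core. (b) If $s$ is even, then $3s/2$ is not a part of $\lambda$.
   Context: A strict partition $\lambda=(\lambda_1>\lambda_2>\cdots>\lambda_\ell)$ is a finite strictly decreasing sequence of positive integers. The bar lengths in the $i$th row of $\lambda$ are the elements of $\{\lambda_i+\lambda_{i+1},\dots,\lambda_i+\lambda_\ell\}\cup\big(\{1,2,\dots,\lambda_i\}\setminus\{\lambda_i-\lambda_{i+1},\dots,\lambda_i-\lambda_\ell\}\big)$. $\lambda$ is an $\overline{s}$-core if $s$ is not a bar length in any row of $\lambda$. The shifted Young diagram $S(\lambda)$ has boxes $(i,j)$ (row $i$, column $j$) with $1\le i\le\ell$ and $i\le j\le i+\lambda_i-1$. The shifted hook length of a box $(i,j)$ is the number of boxes consisting of the box itself, the boxes to its right in row $i$, the boxes below it in column $j$, and all boxes of row $j+1$ of $S(\lambda)$ (if that row exists). $S(\lambda)$ is an $s$-CSYD ($s$-core shifted Young diagram) if no shifted hook length of $S(\lambda)$ is divisible by $s$. *)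

theory Defs
  imports Main
begin

definition strict_partition :: "nat list \<Rightarrow> bool" where
  "strict_partition l \<longleftrightarrow> sorted_wrt (>) l \<and> (\<forall>x \<in> set l. 0 < x)"

text \<open>Rows, columns and the indices of parts are numbered from 1.\<close>

definition part :: "nat list \<Rightarrow> nat \<Rightarrow> nat" where
  "part l i = l ! (i - 1)"

definition bar_lengths :: "nat list \<Rightarrow> nat \<Rightarrow> nat set" where
  "bar_lengths l i =
     {part l i + part l j | j. i < j \<and> j \<le> length l} \<union>
     ({1..part l i} - {part l i - part l j | j. i < j \<and> j \<le> length l})"

definition bar_core :: "nat \<Rightarrow> nat list \<Rightarrow> bool" where
  "bar_core s l \<longleftrightarrow> (\<forall>i \<in> {1..length l}. s \<notin> bar_lengths l i)"

definition shifted_diagram :: "nat list \<Rightarrow> (nat \<times> nat) set" where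
  "shifted_diagram l =
     {(i, j). 1 \<le> i \<and> i \<le> length l \<and> i \<le> j \<and> j \<le> i + part l i - 1}"

text \<open>The last of the three sets is row \<open>j + 1\<close> of the diagram; it is empty if
  there is no such row.\<close>

definition shifted_hook :: "nat list \<Rightarrow> nat \<times> nat \<Rightarrow> (nat \<times> nat) set" where
  "shifted_hook l = (\<lambda>(i, j).
     {(i, j') | j'. j \<le> j' \<and> (i, j') \<in> shifted_diagram l} \<union>
     {(i', j) | i'. i < i' \<and> (i', j) \<in> shifted_diagram l} \<union>
     {(j + 1, k) | k. (j + 1, k) \<in> shifted_diagram l})"

definition shifted_hook_length :: "nat list \<Rightarrow> nat \<times> nat \<Rightarrow> nat" where
  "shifted_hook_length l b = card (shifted_hook l b)"

definition CSYD :: "nat \<Rightarrow> nat list \<Rightarrow> bool" where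
  "CSYD s l \<longleftrightarrow> (\<forall>b \<in> shifted_diagram l. \<not> s dvd shifted_hook_length l b)"

end

theory Submission
  imports Defs
begin

text \<open>
  The shifted hook lengths in row \<open>i\<close> of \<open>S(\<lambda>)\<close> are exactly the bar lengths in row \<open>i\<close>
  (\<open>shifted_hook_lengths_row\<close>), so \<open>S(\<lambda>)\<close> is an \<open>s\<close>-CSYD iff no positive multiple of \<open>s\<close> is a
  bar length of \<open>\<lambda>\<close>. With \<open>\<ell>\<close> parts, the boxes in the columns \<open>j < \<ell>\<close> account for the sums
  \<open>\<lambda>\<^sub>i + \<lambda>\<^bsub>j+1\<^esub>\<close>. In the columns \<open>j \<ge> \<ell>\<close> the hook lengths are distinct, lie in
  \<open>{1..\<lambda>\<^sub>i}\<close> and avoid every difference \<open>\<lambda>\<^sub>i - \<lambda>\<^sub>k\<close>. There are as many of them as such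
  numbers, so they are all of these numbers.

  It remains to compare \<open>s\<close> with its multiples. The bar lengths depend only on the set \<open>X\<close> of parts.
  If \<open>s\<close> is not a bar length, then \<open>X\<close> is closed under subtracting \<open>s\<close> and contains no two
  distinct parts with sum \<open>s\<close>. Hence \<open>X\<close> is closed under subtracting multiples of \<open>s\<close>, and a
  multiple of \<open>s\<close> can only be a bar length as a sum \<open>x + y\<close> of distinct parts. The residues of
  \<open>x\<close> and \<open>y\<close> are then parts with sum \<open>s\<close>, so they coincide with \<open>s/2\<close>. The larger one of
  \<open>x\<close> and \<open>y\<close> is therefore at least \<open>3s/2\<close> and descends to the part \<open>3s/2\<close>. Conversely, if
  \<open>3s/2\<close> is a part then so is \<open>s/2\<close>, and \<open>3s/2 + s/2 = 2s\<close> is a bar length.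
\<close>

section \<open>Parts of a strict partition\<close>

lemma part_pos:
  assumes "strict_partition l" "1 \<le> i" "i \<le> length l"
  shows "0 < part l i"
  using assms by (auto simp: strict_partition_def part_def)

lemma part_strict_antimono:
  assumes "strict_partition l" "1 \<le> i" "i < j" "j \<le> length l"
  shows "part l j < part l i"
  using assms sorted_wrt_nth_less[of "(>)" l "i - 1" "j - 1"]
  by (auto simp: strict_partition_def part_def)

lemma part_less_iff:
  assumes "strict_partition l" "i \<in> {1..length l}" "j \<in> {1..length l}"
  shows "part l j < part l i \<longleftrightarrow> i < j"
  using assms part_strict_antimono[of l i j] part_strict_antimono[of l j i]
  by (cases i j rule: linorder_cases) auto

lemma set_eq_part_image: "set l = part l ` {1..length l}"
proof -
  have "part l (Suc k) = l ! k" for k by (simp add: part_def)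
  moreover have "{1..length l} = Suc ` {..<length l}"
    by (simp add: lessThan_atLeast0 image_Suc_atLeastLessThan atLeastLessThanSuc_atLeastAtMost)
  ultimately show ?thesis
    by (auto simp: set_conv_nth image_image)
qed

text \<open>Row \<open>a\<close> of the shifted diagram ends at column \<open>a + \<lambda>\<^sub>a - 1\<close>. Since the parts drop by at
  least one from row to row, which compensates for the shift, no row ends to the right of an earlier
  one.\<close>

lemma row_end_antimono:
  assumes "strict_partition l" "1 \<le> a" "a \<le> b" "b \<le> length l"
  shows "b + part l b \<le> a + part l a"
  using \<open>a \<le> b\<close> \<open>b \<le> length l\<close>
proof (induction b rule: dec_induct)
  case base
  then show ?case by simp
next
  case (step n)
  then show ?case using part_strict_antimono[of l n "Suc n"] assms by auto
qed

lemma length_less_row_end: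
  assumes "strict_partition l" "1 \<le> a" "a \<le> length l"
  shows "length l < a + part l a"
  using row_end_antimono[of l a "length l"] part_pos[of l "length l"] assms by auto

section \<open>Shifted hook lengths are bar lengths\<close>

definition leg :: "nat list \<Rightarrow> nat \<Rightarrow> nat \<Rightarrow> nat set" where
  "leg l i j = {k. i < k \<and> k \<le> length l \<and> k \<le> j \<and> j < k + part l k}"

lemma finite_leg [simp]: "finite (leg l i j)"
  by (rule finite_subset[of _ "{..j}"]) (auto simp: leg_def)

lemma mem_shifted_diagram_iff:
  assumes "strict_partition l"
  shows "(i, j) \<in> shifted_diagram l \<longleftrightarrow> i \<in> {1..length l} \<and> j \<in> {i..<i + part l i}"
  using part_pos[OF assms, of i] by (auto simp: shifted_diagram_def)

lemma shifted_hook_length_eq: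
  assumes "strict_partition l" "i \<in> {1..length l}" "i \<le> j"
  shows "shifted_hook_length l (i, j) =
    (i + part l i - j) + card (leg l i j) + (if j < length l then part l (j + 1) else 0)"
proof -
  define R where "R = (if j < length l then {j + 1..<j + 1 + part l (j + 1)} else {})"
  let ?A = "Pair i ` {j..<i + part l i}"
  let ?B = "(\<lambda>k. (k, j)) ` leg l i j"
  let ?C = "Pair (j + 1) ` R"
  have "shifted_hook l (i, j) = ?A \<union> ?B \<union> ?C"
    using assms by (auto simp: shifted_hook_def mem_shifted_diagram_iff leg_def R_def)
  moreover have "?A \<inter> ?B = {}" "(?A \<union> ?B) \<inter> ?C = {}"
    using assms by (auto simp: leg_def)
  moreover have "finite R" by (simp add: R_def)
  ultimately have "shifted_hook_length l (i, j) = card ?A + card ?B + card ?C"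
    by (simp add: shifted_hook_length_def card_Un_disjoint)
  moreover have "card ?A = i + part l i - j" "card ?B = card (leg l i j)" "card ?C = card R"
    by (simp_all add: card_image inj_on_def)
  ultimately show ?thesis by (simp add: R_def)
qed

text \<open>No row ends before column \<open>\<ell>\<close>, so all rows from \<open>i\<close> to \<open>j\<close> meet column \<open>j\<close>. The
  \<open>j - i\<close> boxes below \<open>(i, j)\<close> thus make up for those to its left, and the part of the hook in
  row \<open>i\<close> and column \<open>j\<close> has \<open>\<lambda>\<^sub>i\<close> boxes.\<close>

lemma shifted_hook_length_left:
  assumes "strict_partition l" "1 \<le> i" "i \<le> j" "j < length l"
  shows "shifted_hook_length l (i, j) = part l i + part l (j + 1)"
proof -
  have "j < k + part l k" if "i < k" "k \<le> j" for k
    using length_less_row_end[of l k] assms that by auto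
  then have "leg l i j = {i<..j}"
    using assms by (auto simp: leg_def)
  moreover have "length l < i + part l i"
    using length_less_row_end[of l i] assms by auto
  ultimately show ?thesis
    using assms by (simp add: shifted_hook_length_eq)
qed

lemma shifted_hook_length_right:
  assumes "strict_partition l" "i \<in> {1..length l}" "length l \<le> j"
  shows "shifted_hook_length l (i, j) = (i + part l i - j) + card (leg l i j)"
  using assms by (simp add: shifted_hook_length_eq)

text \<open>From column \<open>\<ell>\<close> on, only the right end of a row decides whether it meets column \<open>j\<close>, and
  these ends move left from row to row. The leg is therefore an initial segment of the rows after
  \<open>i\<close>, and its size determines it.\<close>

lemma mem_leg_iff_card:
  assumes "strict_partition l" "i < k" "k \<le> length l" "length l \<le> j"
  shows "k \<in> leg l i j \<longleftrightarrow> k \<le> i + card (leg l i j)"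
proof
  assume k: "k \<in> leg l i j"
  have "{i<..k} \<subseteq> leg l i j"
  proof
    fix a assume "a \<in> {i<..k}"
    then show "a \<in> leg l i j"
      using k row_end_antimono[of l a k] assms by (auto simp: leg_def)
  qed
  then have "card {i<..k} \<le> card (leg l i j)"
    by (rule card_mono[rotated]) simp
  then show "k \<le> i + card (leg l i j)" by simp
next
  assume le: "k \<le> i + card (leg l i j)"
  show "k \<in> leg l i j"
  proof (rule ccontr)
    assume k: "k \<notin> leg l i j"
    have "leg l i j \<subseteq> {i<..<k}"
    proof
      fix a assume a: "a \<in> leg l i j"
      have "\<not> k \<le> a"
        using a k row_end_antimono[of l k a] assms by (auto simp: leg_def)
      then show "a \<in> {i<..<k}" using a by (auto simp: leg_def)
    qed
    then have "card (leg l i j) \<le> card {i<..<k}"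
      by (intro card_mono) auto
    then show False using le assms by simp
  qed
qed

text \<open>If the hook length were \<open>\<lambda>\<^sub>i - \<lambda>\<^sub>k\<close> and the leg had \<open>r\<close> rows, then
  \<open>j = i + r + \<lambda>\<^sub>k\<close>. Row \<open>k\<close> then meets column \<open>j\<close> iff \<open>k > i + r\<close>, whereas the
  rows of the leg are those with \<open>k \<le> i + r\<close>.\<close>

lemma shifted_hook_length_right_not_difference:
  assumes "strict_partition l" "1 \<le> i" "i < k" "k \<le> length l"
    and "length l \<le> j" "j < i + part l i"
  shows "shifted_hook_length l (i, j) \<noteq> part l i - part l k"
proof
  assume "shifted_hook_length l (i, j) = part l i - part l k"
  then have "j = i + card (leg l i j) + part l k"
    using assms part_strict_antimono[of l i k] by (simp add: shifted_hook_length_right)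
  moreover have "k \<in> leg l i j \<longleftrightarrow> j < k + part l k"
    using assms by (auto simp: leg_def)
  ultimately show False
    using mem_leg_iff_card[of l i k j] assms by linarith
qed

lemma card_leg_le: "card (leg l i j) \<le> length l - i"
proof -
  have "leg l i j \<subseteq> {i<..length l}" by (auto simp: leg_def)
  then have "card (leg l i j) \<le> card {i<..length l}" by (rule card_mono[rotated]) simp
  then show ?thesis by simp
qed

text \<open>Moving right shortens the arm by one, while the leg can only lose rows.\<close>

lemma inj_on_shifted_hook_length_right:
  assumes "strict_partition l" "i \<in> {1..length l}"
  shows "inj_on (\<lambda>j. shifted_hook_length l (i, j)) {length l..<i + part l i}"
proof (rule linorder_inj_onI)
  fix a b assume ab: "a < b" "a \<in> {length l..<i + part l i}" "b \<in> {length l..<i + part l i}"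
  then have "leg l i b \<subseteq> leg l i a" by (auto simp: leg_def)
  then have "card (leg l i b) \<le> card (leg l i a)" by (simp add: card_mono)
  with ab assms show "shifted_hook_length l (i, a) \<noteq> shifted_hook_length l (i, b)"
    by (simp add: shifted_hook_length_right)
qed auto

text \<open>It suffices to prove the inclusion from left to right, since both sides have \<open>\<lambda>\<^sub>i - (\<ell> - i)\<close> elements.\<close>

lemma shifted_hook_lengths_right:
  assumes l: "strict_partition l" and i: "i \<in> {1..length l}"
  shows "(\<lambda>j. shifted_hook_length l (i, j)) ` {length l..<i + part l i} =
    {1..part l i} - {part l i - part l k | k. i < k \<and> k \<le> length l}"
    (is "?h ` ?J = _ - ?D")
proof (rule card_subset_eq)
  show "?h ` ?J \<subseteq> {1..part l i} - ?D"
  proof clarify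
    fix j assume j: "j \<in> ?J"
    then have "?h j \<in> {1..part l i}"
      using assms card_leg_le[of l i j] by (auto simp: shifted_hook_length_right)
    moreover have "?h j \<notin> ?D"
      using shifted_hook_length_right_not_difference[of l i _ j] assms j by auto
    ultimately show "?h j \<in> {1..part l i} - ?D" by blast
  qed
  have D: "?D = (\<lambda>k. part l i - part l k) ` {i<..length l}" by auto
  have "inj_on (\<lambda>k. part l i - part l k) {i<..length l}"
  proof (rule linorder_inj_onI)
    fix a b assume "a < b" "a \<in> {i<..length l}" "b \<in> {i<..length l}"
    then show "part l i - part l a \<noteq> part l i - part l b"
      using part_strict_antimono[of l a b] part_strict_antimono[of l i a] assms by auto
  qed auto
  then have "card ?D = length l - i" by (simp add: D card_image)
  moreover have "?D \<subseteq> {1..part l i}"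
    using part_strict_antimono[OF l, of i] i by (fastforce simp: Suc_le_eq)
  moreover have "finite ?D" by (simp add: D)
  ultimately have "card ({1..part l i} - ?D) = part l i - (length l - i)"
    by (simp add: card_Diff_subset)
  moreover have "card (?h ` ?J) = i + part l i - length l"
    using card_image[OF inj_on_shifted_hook_length_right[OF assms]] by simp
  ultimately show "card (?h ` ?J) = card ({1..part l i} - ?D)"
    using i by simp
qed simp

lemma shifted_hook_lengths_row:
  assumes "strict_partition l" "i \<in> {1..length l}"
  shows "(\<lambda>j. shifted_hook_length l (i, j)) ` {i..<i + part l i} = bar_lengths l i"
    (is "?h ` _ = _")
proof -
  have "{i..<i + part l i} = {i..<length l} \<union> {length l..<i + part l i}"
    using assms length_less_row_end[of l i] by auto
  moreover have "?h ` {i..<length l} = (\<lambda>j. part l i + part l (j + 1)) ` {i..<length l}"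
    using assms by (intro image_cong) (auto simp: shifted_hook_length_left)
  moreover have "\<dots> = (\<lambda>k. part l i + part l k) ` Suc ` {i..<length l}"
    by (simp add: image_image del: image_Suc_atLeastLessThan)
  moreover have "\<dots> = {part l i + part l k | k. i < k \<and> k \<le> length l}"
    unfolding image_Suc_atLeastLessThan by (auto simp: Suc_le_eq)
  ultimately show ?thesis
    using assms by (simp add: image_Un shifted_hook_lengths_right bar_lengths_def)
qed

section \<open>Bar lengths in terms of the set of parts\<close>

text \<open>In this form the restriction to later rows disappears: a part of the form \<open>x - n\<close> with
  \<open>1 \<le> n \<le> x\<close> is smaller than \<open>x\<close> and so belongs to a later row. The case \<open>n = x\<close> makes
  every part a bar length, as \<open>0\<close> is not a part.\<close>

definition bar_length_of :: "nat set \<Rightarrow> nat \<Rightarrow> bool" where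
  "bar_length_of X n \<longleftrightarrow>
     (\<exists>x \<in> X. (\<exists>y \<in> X. y < x \<and> n = x + y) \<or> (1 \<le> n \<and> n \<le> x \<and> x - n \<notin> X))"

lemma bar_length_of_set_iff:
  assumes l: "strict_partition l"
  shows "bar_length_of (set l) n \<longleftrightarrow> (\<exists>i \<in> {1..length l}. n \<in> bar_lengths l i)"
proof -
  have "n \<in> bar_lengths l i \<longleftrightarrow>
      (\<exists>y \<in> set l. y < part l i \<and> n = part l i + y) \<or>
      (1 \<le> n \<and> n \<le> part l i \<and> part l i - n \<notin> set l)"
    if i: "i \<in> {1..length l}" for i
  proof -
    have later: "(\<exists>j. P (part l j) \<and> i < j \<and> j \<le> length l) \<longleftrightarrow> (\<exists>y \<in> set l. P y \<and> y < part l i)"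
      for P
      using i part_less_iff[OF l i] unfolding set_eq_part_image by fastforce
    have "(\<exists>y \<in> set l. n = part l i - y \<and> y < part l i) \<longleftrightarrow> part l i - n \<in> set l"
      if n: "1 \<le> n" "n \<le> part l i"
    proof
      assume "part l i - n \<in> set l"
      then show "\<exists>y \<in> set l. n = part l i - y \<and> y < part l i"
        using n by (intro bexI[of _ "part l i - n"]) auto
    qed auto
    then show ?thesis
      using later[of "\<lambda>y. n = part l i + y"] later[of "\<lambda>y. n = part l i - y"]
      by (auto simp: bar_lengths_def)
  qed
  then show ?thesis
    unfolding bar_length_of_def set_eq_part_image[of l] by (simp add: bex_simps)
qed

lemma CSYD_iff_bar_length_of:
  assumes "strict_partition l"
  shows "CSYD s l \<longleftrightarrow> (\<forall>n. s dvd n \<longrightarrow> \<not> bar_length_of (set l) n)"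
proof -
  have "CSYD s l \<longleftrightarrow> (\<forall>i \<in> {1..length l}. \<forall>n \<in> bar_lengths l i. \<not> s dvd n)"
    using assms unfolding CSYD_def
    by (auto simp: mem_shifted_diagram_iff simp flip: shifted_hook_lengths_row)
  then show ?thesis
    using bar_length_of_set_iff[OF assms] by blast
qed

section \<open>Multiples of a number as bar lengths\<close>

lemma diff_multiple_mem:
  fixes X :: "nat set"
  assumes closed: "\<And>x. x \<in> X \<Longrightarrow> s \<le> x \<Longrightarrow> x - s \<in> X" and "x \<in> X" "k * s \<le> x"
  shows "x - k * s \<in> X"
  using \<open>k * s \<le> x\<close>
proof (induction k)
  case 0
  then show ?case using \<open>x \<in> X\<close> by simp
next
  case (Suc k)
  then have "x - k * s - s \<in> X" by (intro closed) auto
  then show ?case by (simp add: add.commute)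
qed

lemma sum_eq_modulus_if_dvd:
  fixes a b s :: nat
  assumes "s dvd a + b" "0 < a" "a < s" "b < s"
  shows "a + b = s"
proof -
  obtain k where k: "a + b = s * k" using assms by (auto elim: dvdE)
  then have "s * k < s * 2" "0 < s * k" using assms by linarith+
  then have "k = 1" by simp
  then show ?thesis using k by simp
qed

lemma no_multiple_bar_length_iff:
  assumes s: "0 < s" and X: "0 \<notin> X"
  shows "(\<forall>n. s dvd n \<longrightarrow> \<not> bar_length_of X n) \<longleftrightarrow>
    \<not> bar_length_of X s \<and> (even s \<longrightarrow> 3 * s div 2 \<notin> X)"
proof (intro iffI conjI impI notI)
  assume none: "\<forall>n. s dvd n \<longrightarrow> \<not> bar_length_of X n"
  then show False if "bar_length_of X s" using that by simp
  assume "even s" and mem: "3 * s div 2 \<in> X"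
  then obtain t where t: "s = 2 * t" by (auto elim: evenE)
  have "3 * t \<in> X" using mem t by simp
  moreover have "t \<in> X"
    using none[rule_format, of s] \<open>3 * t \<in> X\<close> s t by (force simp: bar_length_of_def)
  ultimately have "bar_length_of X (4 * t)"
    using s t unfolding bar_length_of_def by (intro bexI[of _ "3 * t"] disjI1 bexI[of _ t]) auto
  then show False using none[rule_format, of "4 * t"] t by simp
next
  assume R: "\<not> bar_length_of X s \<and> (even s \<longrightarrow> 3 * s div 2 \<notin> X)"
  then have no_sum: "x + y \<noteq> s" if "x \<in> X" "y \<in> X" "y < x" for x y
    using that by (auto simp: bar_length_of_def)
  have "x - s \<in> X" if "x \<in> X" "s \<le> x" for x
    using R s that by (auto simp: bar_length_of_def)
  note descend = diff_multiple_mem[of X s, OF this]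
  have residue: "x mod s \<in> X" if "x \<in> X" for x
    using descend[OF _ _ that, of "x div s"] by (simp add: minus_div_mult_eq_mod)
  have no_diff: "x - n \<in> X" if "x \<in> X" "s dvd n" "n \<le> x" for x n
    using that descend[OF _ _ \<open>x \<in> X\<close>] by (auto elim!: dvdE simp: mult.commute)
  show "\<forall>n. s dvd n \<longrightarrow> \<not> bar_length_of X n"
  proof (intro allI impI notI)
    fix n assume n: "s dvd n" "bar_length_of X n"
    then obtain x y where xy: "x \<in> X" "y \<in> X" "y < x" "n = x + y"
      using no_diff unfolding bar_length_of_def by blast
    have "s dvd x mod s + y mod s"
      using n xy by (simp add: dvd_eq_mod_eq_0 mod_add_eq)
    moreover have "0 < x mod s" using residue[OF \<open>x \<in> X\<close>] X by (metis neq0_conv)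
    ultimately have sum: "x mod s + y mod s = s"
      using s by (intro sum_eq_modulus_if_dvd) auto
    then have same: "x mod s = y mod s"
      using no_sum[of "x mod s" "y mod s"] no_sum[of "y mod s" "x mod s"] residue xy
      by (metis add.commute linorder_neqE_nat)
    \<comment> \<open>Two equal residues with sum \<open>s\<close> are both \<open>s/2\<close>, and \<open>y < x\<close> leaves room to subtract
      multiples of \<open>s\<close> from \<open>x\<close> down to \<open>s/2 + s\<close>.\<close>
    define r where "r = x mod s"
    have s_eq: "s = 2 * r"
      using sum same by (simp add: r_def)
    have "y div s < x div s"
      using same \<open>y < x\<close> by (metis div_le_mono div_mult_mod_eq le_neq_implies_less less_imp_le nat_neq_iff)
    then obtain q where "x div s = Suc q" by (cases "x div s") auto
    then have "x = q * s + (s + r)"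
      unfolding r_def using div_mult_mod_eq[of x s] by simp
    then have "s + r \<in> X"
      using no_diff[of x "q * s"] xy by simp
    moreover have "s + r = 3 * s div 2" "even s"
      by (simp_all add: s_eq)
    ultimately show False using R by simp
  qed
qed

theorem proposition2p4:
  fixes s :: nat and l :: "nat list"
  assumes "s > 0" and "strict_partition l"
  shows "CSYD s l \<longleftrightarrow> bar_core s l \<and> (even s \<longrightarrow> 3 * s div 2 \<notin> set l)"
proof -
  have "0 \<notin> set l"
    using assms by (auto simp: strict_partition_def)
  moreover have "bar_core s l \<longleftrightarrow> \<not> bar_length_of (set l) s"
    using assms by (auto simp: bar_core_def bar_length_of_set_iff)
  ultimately show ?thesis
    using assms by (simp add: CSYD_iff_bar_length_of no_multiple_bar_length_iff)
qed

end
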